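(* Let $N$ be a positive integer, $a\in\mathbb{R}$, $b\in[0,1]$. For all $k,l,k',l'\in\{0,\dots,N-1\}$ with $k>l$ and $k'>l'$, $$\sum_{\substack{m,n=0\\ m>n}}^{N-1}E^-_{(k,l)}(x_m,y_n)\,\overline{E^-_{(k',l')}(x_m,y_n)}=N^2\,\delta_{kk'}\delta_{ll'}.$$ Moreover, if $N=2M+1$ is odd, the same relation also holds for all $k,l,k',l'\in\{-M,\dots,M\}$ with $k>l$ and $k'>l'$.
   Context: For $k,l\in\mathbb{Z}$ and $x,y\in\mathbb{R}$, the antisymmetric exponential function is $E^-_{(k,l)}(x,y)=e^{2\pi i(kx+ly)}-e^{2\pi i(ky+lx)}$. The grid points are $(x_m,y_n)=\left(a+\frac{m+b}{N},\,a+\frac{n+b}{N}\right)$ for $m,n\in\{0,\dots,N-1\}$. $\delta$ is the Kronecker delta. *)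

theory Defs
  imports "HOL-Analysis.Analysis"
begin

definition E_minus :: "int \<Rightarrow> int \<Rightarrow> real \<Rightarrow> real \<Rightarrow> complex" where
  "E_minus k l x y =
     exp (2 * complex_of_real pi * \<i> * complex_of_real (of_int k * x + of_int l * y))
   - exp (2 * complex_of_real pi * \<i> * complex_of_real (of_int k * y + of_int l * x))"

text \<open>Both coordinates of the grid point with indices \<open>m\<close>, \<open>n\<close> come from the same
  one-dimensional grid: \<open>x\<^sub>m = grid_pt N a b m\<close> and \<open>y\<^sub>n = grid_pt N a b n\<close>.\<close>

definition grid_pt :: "nat \<Rightarrow> real \<Rightarrow> real \<Rightarrow> nat \<Rightarrow> real" where
  "grid_pt N a b m = a + (real m + b) / real N"

definition kronecker_delta :: "int \<Rightarrow> int \<Rightarrow> complex" where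
  "kronecker_delta i j = (if i = j then 1 else 0)"

end

theory Submission
  imports Defs
begin

text \<open>
  The summand is symmetric in \<open>m\<close>, \<open>n\<close> and vanishes on the diagonal, so twice the sum over
  \<open>m > n\<close> is the sum over the full square. There it factorises into inner products of
  one-dimensional exponentials, giving
  \<open>2 (\<langle>k, k'\<rangle> \<langle>l, l'\<rangle> - \<langle>k, l'\<rangle> \<langle>l, k'\<rangle>)\<close>, and each inner product is \<open>N\<close> times a Kronecker delta as
  long as the frequencies differ by less than \<open>N\<close>. The second product vanishes, since \<open>k = l'\<close>
  and \<open>l = k'\<close> would contradict \<open>k > l\<close> and \<open>k' > l'\<close>.
\<close>

definition grid_exp :: "nat \<Rightarrow> real \<Rightarrow> real \<Rightarrow> int \<Rightarrow> nat \<Rightarrow> complex" where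
  "grid_exp N a b k m = cis (2 * pi * of_int k * grid_pt N a b m)"

lemma E_minus_grid:
  "E_minus k l (grid_pt N a b m) (grid_pt N a b n) =
     grid_exp N a b k m * grid_exp N a b l n - grid_exp N a b k n * grid_exp N a b l m"
  unfolding E_minus_def grid_exp_def cis_conv_exp exp_add[symmetric]
  by (simp add: algebra_simps)

text \<open>Equality would make \<open>j / N\<close> an integer, so \<open>N\<close> would divide a
  nonzero integer of smaller absolute value.\<close>

lemma cis_2pi_fraction_neq_1:
  fixes j :: int and N :: nat
  assumes "j \<noteq> 0" "\<bar>j\<bar> < int N"
  shows "cis (2 * pi * of_int j / real N) \<noteq> 1"
proof
  assume "cis (2 * pi * of_int j / real N) = 1"
  then have "cos (2 * pi * of_int j / real N) = 1"
    by (simp add: complex_eq_iff)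
  then obtain i :: int where "2 * pi * of_int j / real N = of_int i * (2 * pi)"
    by (auto simp: cos_one_2pi_int)
  then have "real_of_int j = of_int i * real N"
    using assms by (simp add: field_simps)
  then have "j = i * int N"
    by (metis of_int_eq_iff of_int_mult of_int_of_nat_eq)
  then have "int N dvd j" by simp
  then show False
    using assms zdvd_not_zless[of "\<bar>j\<bar>" "int N"] by auto
qed

text \<open>For distinct frequencies the summands form a geometric progression whose ratio
  \<open>w\<close> is a nontrivial \<open>N\<close>-th root of unity; the grid offset
  \<open>a + b / N\<close> only contributes the constant phase \<open>c\<close>.\<close>

lemma grid_exp_orthogonal:
  fixes k l :: int
  assumes "\<bar>k - l\<bar> < int N"
  shows "(\<Sum>m<N. grid_exp N a b k m * cnj (grid_exp N a b l m)) = of_nat N * kronecker_delta k l"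
proof (cases "k = l")
  case True
  then show ?thesis
    by (simp add: grid_exp_def kronecker_delta_def cis_cnj cis_mult)
next
  case False
  define w where "w = cis (2 * pi * of_int (k - l) / real N)"
  define c where "c = cis (2 * pi * of_int (k - l) * (a + b / real N))"
  have "w \<noteq> 1"
    using cis_2pi_fraction_neq_1[of "k - l" N] assms False by (simp add: w_def)
  moreover have "w ^ N = 1"
  proof -
    \<comment> \<open>The bound in \<open>assms\<close> forces \<open>N > 0\<close>, so the division
      cancels.\<close>
    have "real N * (2 * pi * of_int (k - l) / real N) = 2 * pi * of_int (k - l)"
      using assms by simp
    then have "w ^ N = cis (2 * pi * of_int (k - l))"
      unfolding w_def Complex.DeMoivre by (rule arg_cong)
    also have "\<dots> = 1"
      by (rule cis_multiple_2pi) simp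
    finally show ?thesis .
  qed
  ultimately have "(\<Sum>m<N. w ^ m) = 0"
    by (simp add: sum_gp_strict)
  moreover have "grid_exp N a b k m * cnj (grid_exp N a b l m) = c * w ^ m" for m
    unfolding grid_exp_def w_def c_def cis_cnj cis_mult Complex.DeMoivre grid_pt_def
    by (rule arg_cong[of _ _ cis]) (simp add: algebra_simps add_divide_distrib diff_divide_distrib)
  ultimately show ?thesis
    using False by (simp add: kronecker_delta_def flip: sum_distrib_left)
qed

lemma sum_strict_lower_triangle:
  fixes f :: "nat \<Rightarrow> nat \<Rightarrow> complex"
  assumes sym: "\<And>m n. f m n = f n m" and diag: "\<And>m. f m m = 0"
  shows "2 * (\<Sum>(m, n) \<in> {(m, n). m < N \<and> n < N \<and> n < m}. f m n) = (\<Sum>m<N. \<Sum>n<N. f m n)"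
proof -
  let ?L = "{(m, n). m < N \<and> n < N \<and> n < m}" and ?U = "{(m, n). m < N \<and> n < N \<and> m < n}"
  let ?D = "{(m, n). m < N \<and> n < N \<and> m = n}"
  have fin: "finite ?L" "finite ?U" "finite ?D"
    by (auto intro: finite_subset[of _ "{..<N} \<times> {..<N}"])
  have "{..<N} \<times> {..<N} = (?L \<union> ?U) \<union> ?D" by auto
  then have "(\<Sum>m<N. \<Sum>n<N. f m n) = (\<Sum>(m, n) \<in> (?L \<union> ?U) \<union> ?D. f m n)"
    by (simp add: sum.cartesian_product)
  also have "\<dots> = (\<Sum>(m, n) \<in> ?L. f m n) + (\<Sum>(m, n) \<in> ?U. f m n) + (\<Sum>(m, n) \<in> ?D. f m n)"
    using fin by (subst sum.union_disjoint; (subst sum.union_disjoint)?) auto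
  also have "(\<Sum>(m, n) \<in> ?D. f m n) = 0"
    by (rule sum.neutral) (auto simp: diag)
  also have "(\<Sum>(m, n) \<in> ?U. f m n) = (\<Sum>(m, n) \<in> ?L. f m n)"
    by (rule sum.reindex_bij_witness[of _ prod.swap prod.swap]) (auto simp: sym)
  finally show ?thesis by simp
qed

text \<open>Only the four frequency differences occurring in the inner products are bounded, so that
  one lemma serves both frequency ranges.\<close>

lemma E_minus_orthogonal:
  fixes k l k' l' :: int
  assumes "k > l" "k' > l'"
    and "\<bar>k - k'\<bar> < int N" "\<bar>l - l'\<bar> < int N" "\<bar>k - l'\<bar> < int N" "\<bar>l - k'\<bar> < int N"
  shows "(\<Sum>(m, n) \<in> {(m, n). m \<in> {0..N - 1} \<and> n \<in> {0..N - 1} \<and> m > n}.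
            E_minus k l (grid_pt N a b m) (grid_pt N a b n)
            * cnj (E_minus k' l' (grid_pt N a b m) (grid_pt N a b n)))
         = of_nat N ^ 2 * kronecker_delta k k' * kronecker_delta l l'"
proof -
  let ?e = "grid_exp N a b"
  let ?p = "\<lambda>i j m. ?e i m * cnj (?e j m)"
  let ?f = "\<lambda>m n. E_minus k l (grid_pt N a b m) (grid_pt N a b n)
            * cnj (E_minus k' l' (grid_pt N a b m) (grid_pt N a b n))"
  have f: "?f m n = ?p k k' m * ?p l l' n - ?p k l' m * ?p l k' n
                  - ?p l k' m * ?p k l' n + ?p l l' m * ?p k k' n" for m n
    by (simp add: E_minus_grid algebra_simps)
  \<comment> \<open>Since \<open>assms(3)\<close> gives \<open>N > 0\<close>, the truncated
    \<open>N - 1\<close> is the true predecessor.\<close>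
  have set_eq: "{(m, n). m \<in> {0..N - 1} \<and> n \<in> {0..N - 1} \<and> m > n}
              = {(m, n). m < N \<and> n < N \<and> n < m}"
    using assms(3) by auto
  \<comment> \<open>Swapping \<open>m\<close> and \<open>n\<close> flips the sign of both
    \<open>E_minus\<close> factors, so their product is symmetric; each factor is 0 for
    \<open>m = n\<close>.\<close>
  have "2 * (\<Sum>(m, n) \<in> {(m, n). m < N \<and> n < N \<and> n < m}. ?f m n) = (\<Sum>m<N. \<Sum>n<N. ?f m n)"
    by (rule sum_strict_lower_triangle) (simp_all add: E_minus_grid algebra_simps)
  also have "\<dots> = (\<Sum>m<N. ?p k k' m) * (\<Sum>n<N. ?p l l' n) - (\<Sum>m<N. ?p k l' m) * (\<Sum>n<N. ?p l k' n)
                - (\<Sum>m<N. ?p l k' m) * (\<Sum>n<N. ?p k l' n) + (\<Sum>m<N. ?p l l' m) * (\<Sum>n<N. ?p k k' n)"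
    unfolding f sum.distrib sum_subtractf sum_product ..
  \<comment> \<open>The outer two products agree, and so do the inner two.\<close>
  also have "\<dots> = 2 * (of_nat N ^ 2 * kronecker_delta k k' * kronecker_delta l l')
                - 2 * (of_nat N ^ 2 * kronecker_delta k l' * kronecker_delta l k')"
    using assms by (simp add: grid_exp_orthogonal power2_eq_square algebra_simps)
  \<comment> \<open>A nonzero cross term would give \<open>k = l' < k' = l < k\<close>.\<close>
  also have "\<dots> = 2 * (of_nat N ^ 2 * kronecker_delta k k' * kronecker_delta l l')"
    using assms(1,2) by (simp add: kronecker_delta_def)
  finally show ?thesis
    unfolding set_eq by simp
qed

theorem mainTheorem3:
  fixes N :: nat and a b :: real
  assumes "N > 0" and "b \<in> {0..1}"
  shows "(\<forall>k\<in>{0..int N - 1}. \<forall>l\<in>{0..int N - 1}. \<forall>k'\<in>{0..int N - 1}. \<forall>l'\<in>{0..int N - 1}.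
            k > l \<longrightarrow> k' > l' \<longrightarrow>
            (\<Sum>(m, n) \<in> {(m, n). m \<in> {0..N - 1} \<and> n \<in> {0..N - 1} \<and> m > n}.
               E_minus k l (grid_pt N a b m) (grid_pt N a b n)
               * cnj (E_minus k' l' (grid_pt N a b m) (grid_pt N a b n)))
            = of_nat N ^ 2 * kronecker_delta k k' * kronecker_delta l l')
       \<and> (\<forall>M::nat. N = 2 * M + 1 \<longrightarrow>
            (\<forall>k\<in>{- int M..int M}. \<forall>l\<in>{- int M..int M}. \<forall>k'\<in>{- int M..int M}. \<forall>l'\<in>{- int M..int M}.
               k > l \<longrightarrow> k' > l' \<longrightarrow>
               (\<Sum>(m, n) \<in> {(m, n). m \<in> {0..N - 1} \<and> n \<in> {0..N - 1} \<and> m > n}.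
                  E_minus k l (grid_pt N a b m) (grid_pt N a b n)
                  * cnj (E_minus k' l' (grid_pt N a b m) (grid_pt N a b n)))
               = of_nat N ^ 2 * kronecker_delta k k' * kronecker_delta l l'))"
  \<comment> \<open>Each range consists of \<open>N\<close> consecutive integers, so differences are
    at most \<open>N - 1\<close>, which is \<open>2 * M\<close> in the odd case.\<close>
  by (intro conjI ballI allI impI E_minus_orthogonal) auto

end
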